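(* Let $\mathbb{F}=\mathbb{R}$ or $\mathbb{C}$, let $n,m\in\mathbb{N}_+$ with $m\leq n$, and let $\Lambda=\mathrm{diag}(\lambda_1,\dots,\lambda_n)\in\mathbb{F}^{n\times n}$ with $|\lambda_1|>\dots>|\lambda_n|>0$. Assume $X\in\mathbb{F}^{n\times m}$ satisfies $\det(X(1:j,1:j))\neq 0$ for every $j\in[m]$. Then there exist a unique unit lower triangular $L\in\mathbb{F}^{n\times m}$ and a unique upper triangular $U\in\mathbb{F}^{m\times m}$ such that $X=LU$. Assume further that all strictly lower triangular entries of $L$ and of $L(1:m,:)^{-1}$ are nonzero. For each $k\in\mathbb{N}_+$ let $Q_kR_k=\Lambda^kX$ be a QR factorization of $\Lambda^kX$. Then for every $j\in[m]$, as $k\to\infty$, \[ |Q_k(i,j)|=\begin{cases} |(L(1:m,:)^{-1})(j,i)|\,\dfrac{|\lambda_j|^k}{|\lambda_i|^k}(1+o(1)),& i\in[j-1],\\[2mm] 1+o(1),& i=j,\\[1mm] |L(i,j)|\,\dfrac{|\lambda_i|^k}{|\lambda_j|^k}(1+o(1)),& i\in[n]\setminus[j]. \end{cases} \]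
   Context: Notation: $[r]=\{1,\dots,r\}$ (with $[0]=\emptyset$). $M(i,j)$ is the $(i,j)$ entry of a matrix $M$; $M(a:b,c:d)$ is the submatrix with rows $a,\dots,b$ and columns $c,\dots,d$, and $M(a:b,:)$ keeps all columns. An $n\times m$ matrix $L$ with $n\ge m$ is unit lower triangular if $L(j,j)=1$ for $j\in[m]$ and $L(i,j)=0$ for $i<j$; its strictly lower triangular entries are those with $i>j$. A QR factorization of an $n\times m$ matrix $M$ of full column rank is $M=QR$ with $Q\in\mathbb{F}^{n\times m}$ having orthonormal columns and $R\in\mathbb{F}^{m\times m}$ upper triangular. $o(1)$ denotes a quantity tending to $0$ as $k\to\infty$ (with $n,m,\Lambda,X,i,j$ fixed). *)

theory Defs
  imports
    Complex_Main
    "Jordan_Normal_Form.Determinant"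
    "Jordan_Normal_Form.DL_Submatrix"
    "Jordan_Normal_Form.Gauss_Jordan_Elimination"
begin

(* The scalar fields "R or C", with the modulus as norm. The class has no other members up to
   isomorphism: expanding the axiom at 1 + x shows that x + conjugate x is real, and
   x * conjugate x is real by the axiom itself, so x is a root of the real quadratic
   t^2 - (x + conjugate x) t + x * conjugate x; an instance is thus an algebraic field extension
   of R of the form R or C, and the axiom forces norm and conjugate to be the usual ones. *)
class real_or_complex = real_normed_field + conjugatable_field +
  assumes mult_conjugate_eq_norm: "x * conjugate x = scaleR ((norm x)\<^sup>2) 1"

instance real :: real_or_complex
  by standard (simp add: power2_eq_square)

instance complex :: real_or_complex
  by standard (simp add: complex_norm_square[symmetric] scaleR_conv_of_real)

(* Library matrices are indexed from 0, so the (i,j) entry of M is M $$ (i - 1, j - 1). *)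

definition unit_lower_triangular :: "'a::zero_neq_one mat \<Rightarrow> bool" where
  "unit_lower_triangular L \<longleftrightarrow>
     dim_col L \<le> dim_row L \<and>
     (\<forall>j<dim_col L. L $$ (j, j) = 1) \<and>
     (\<forall>i<dim_row L. \<forall>j<dim_col L. i < j \<longrightarrow> L $$ (i, j) = 0)"

definition strictly_lower_nonzero :: "'a::zero mat \<Rightarrow> bool" where
  "strictly_lower_nonzero M \<longleftrightarrow>
     (\<forall>i<dim_row M. \<forall>j<dim_col M. j < i \<longrightarrow> M $$ (i, j) \<noteq> 0)"

definition is_LU :: "nat \<Rightarrow> nat \<Rightarrow> 'a::field mat \<Rightarrow> 'a mat \<Rightarrow> 'a mat \<Rightarrow> bool" where
  "is_LU n m X L U \<longleftrightarrow>
     L \<in> carrier_mat n m \<and> unit_lower_triangular L \<and>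
     U \<in> carrier_mat m m \<and> upper_triangular U \<and>
     X = L * U"

definition is_QR :: "nat \<Rightarrow> nat \<Rightarrow> 'a::conjugatable_field mat \<Rightarrow> 'a mat \<Rightarrow> 'a mat \<Rightarrow> bool" where
  "is_QR n m M Q R \<longleftrightarrow>
     Q \<in> carrier_mat n m \<and>
     (\<forall>a<m. \<forall>b<m. col Q a \<bullet>c col Q b = (if a = b then 1 else 0)) \<and>
     R \<in> carrier_mat m m \<and> upper_triangular R \<and>
     M = Q * R"

(* L(1:m,:)^{-1}. The top block of a unit lower triangular matrix is unit lower triangular,
   hence invertible, so "the" is never applied to None where this is used. *)
definition top_inverse :: "nat \<Rightarrow> 'a::field mat \<Rightarrow> 'a mat" where
  "top_inverse m L = the (mat_inverse (submatrix L {..<m} UNIV))"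

end

(* Writing X V = L with V = U^-1 upper triangular, A^k L A_1^-k = Q_k S_k for A = Lambda, A_1 its leading
   m x m block and S_k = R_k V A_1^-k upper triangular. The left-hand side has entries
   L(i,j) (lambda_i / lambda_j)^k and tends to the first m columns of the identity, so orthonormality
   forces S_k to become diagonal with unimodular entries, and back substitution gives the entries of
   Q_k on and below the diagonal. Those above it come from multiplying Q_k^* (A^k L A_1^-k) = S_k on
   the right by A_1^k L(1:m,:)^-1. *)

theory Submission
  imports Defs
begin

section \<open>Triangular matrices, leading submatrices and inverses\<close>

lemma upper_triangular_mult:
  assumes "upper_triangular A" "upper_triangular B"
    and A: "A \<in> carrier_mat n n" and B: "B \<in> carrier_mat n n"
  shows "upper_triangular (A * B)"
proof (rule upper_triangularI)
  fix i j assume ji: "j < i" "i < dim_row (A * B)"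
  then have "(A * B) $$ (i, j) = (\<Sum>l<n. A $$ (i, l) * B $$ (l, j))"
    using A B by (simp add: scalar_prod_def atLeast0LessThan)
  also have "\<dots> = 0"
  proof (intro sum.neutral ballI)
    fix l assume "l \<in> {..<n}"
    then show "A $$ (i, l) * B $$ (l, j) = 0"
      using assms ji upper_triangularD[of A l i] upper_triangularD[of B j l] by (cases "l < i") auto
  qed
  finally show "(A * B) $$ (i, j) = 0" .
qed

lemma upper_triangular_det_nonzero_diag:
  fixes V :: "'a::field mat"
  assumes "upper_triangular V" "V \<in> carrier_mat n n" "det V \<noteq> 0" "i < n"
  shows "V $$ (i, i) \<noteq> 0"
  using assms(2-) by (simp add: det_upper_triangular[OF assms(1,2)] prod_list_diag_prod)

text \<open>Back substitution in a column of \<open>V * W = 1\<^sub>m n\<close>: below the diagonal,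
  row \<open>i\<close> reduces to \<open>V $$ (i, i) * W $$ (i, j) = 0\<close>, and the pivot is
  nonzero because \<open>det V\<close> is.\<close>

lemma upper_triangular_right_inverse:
  fixes V W :: "'a::field mat"
  assumes V: "V \<in> carrier_mat n n" "upper_triangular V"
    and W: "W \<in> carrier_mat n n" and VW: "V * W = 1\<^sub>m n"
  shows "upper_triangular W"
proof -
  have "det V * det W = 1" using det_mult[OF V(1) W] by (simp add: VW)
  then have "det V \<noteq> 0" by auto
  have *: "W $$ (i, j) = 0" if "j < i" "i < n" for i j
    using that
  \<comment> \<open>Induction on \<open>n - i\<close> runs from the last row upwards, so the entries
    of \<open>W\<close> under row \<open>i\<close> are already known to vanish.\<close>
  proof (induction "n - i" arbitrary: i rule: less_induct)
    case less
    have "0 = (V * W) $$ (i, j)" using less.prems by (simp add: VW)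
    also have "\<dots> = (\<Sum>l<n. V $$ (i, l) * W $$ (l, j))"
      using V W less.prems by (simp add: scalar_prod_def atLeast0LessThan)
    also have "\<dots> = (\<Sum>l\<in>{i}. V $$ (i, l) * W $$ (l, j))"
    proof (intro sum.mono_neutral_right ballI)
      fix l assume "l \<in> {..<n} - {i}"
      then show "V $$ (i, l) * W $$ (l, j) = 0"
        using V less.prems less.hyps[of l] upper_triangularD[of V l i]
        by (cases "l < i") (auto simp: diff_less_mono2)
    qed (use less.prems in auto)
    finally show ?case
      using upper_triangular_det_nonzero_diag[OF V(2,1) \<open>det V \<noteq> 0\<close> less.prems(2)] by simp
  qed
  show ?thesis by (rule upper_triangularI) (use * W in auto)
qed

text \<open>On an initial segment \<open>pick\<close> is the identity, so these submatrices keep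
  their indices. The \<open>UNIV\<close> form is the one used in \<open>top_inverse\<close>.\<close>

lemma submatrix_initial:
  assumes "A \<in> carrier_mat n m" "a \<le> n"
  shows "b \<le> m \<Longrightarrow> submatrix A {..<a} {..<b} = Matrix.mat a b (\<lambda>(i, j). A $$ (i, j))"
    and "submatrix A {..<a} UNIV = Matrix.mat a m (\<lambda>(i, j). A $$ (i, j))"
proof -
  have pick: "pick {..<c} i = i" if "i < c" for c i :: nat
  proof -
    have "{a \<in> {..<c}. a < i} = {..<i}" using that by auto
    then show ?thesis using pick_card_in_set[of i "{..<c}"] that by simp
  qed
  have card: "{i. i < d \<and> i < c} = {..<c}" if "c \<le> d" for c d :: nat
    using that by auto
  show "submatrix A {..<a} {..<b} = Matrix.mat a b (\<lambda>(i, j). A $$ (i, j))" if "b \<le> m"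
    by (rule eq_matI) (use assms that in \<open>auto simp: dim_submatrix submatrix_index card pick\<close>)
  show "submatrix A {..<a} UNIV = Matrix.mat a m (\<lambda>(i, j). A $$ (i, j))"
    by (rule eq_matI) (use assms in \<open>auto simp: dim_submatrix submatrix_index card pick pick_UNIV\<close>)
qed

lemma det_nonzero_inverse:
  fixes A :: "'a::field mat"
  assumes A: "A \<in> carrier_mat n n" and "det A \<noteq> 0"
  obtains B where "B \<in> carrier_mat n n" "A * B = 1\<^sub>m n" "B * A = 1\<^sub>m n" "mat_inverse A = Some B"
proof (cases "mat_inverse A")
  case None
  \<comment> \<open>A nonzero determinant makes \<open>A\<close> a unit of the matrix ring, which
    excludes \<open>None\<close>; \<open>()\<close> fills the free parameter of that ring in the
    same way in both facts.\<close>
  from mat_inverse(1)[OF A None, of "()"] det_non_zero_imp_unit[OF assms, of "()"] show ?thesis by blast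
next
  case (Some B)
  with mat_inverse(2)[OF A Some] show ?thesis by (intro that) auto
qed

section \<open>Top blocks and the LU factorization\<close>

lemma submatrix_top_mult:
  assumes "A \<in> carrier_mat n m" "B \<in> carrier_mat m r" "a \<le> n"
  shows "submatrix (A * B) {..<a} UNIV = submatrix A {..<a} UNIV * B"
proof -
  have AB: "A * B \<in> carrier_mat n r" using assms by simp
  show ?thesis
    unfolding submatrix_initial(2)[OF assms(1,3)] submatrix_initial(2)[OF AB assms(3)]
    by (rule eq_matI) (use assms in \<open>auto simp: scalar_prod_def\<close>)
qed

lemma unit_lower_triangular_top:
  assumes "unit_lower_triangular L" "L \<in> carrier_mat n m"
  shows "submatrix L {..<m} UNIV \<in> carrier_mat m m" and "det (submatrix L {..<m} UNIV) = 1"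
proof -
  have L: "submatrix L {..<m} UNIV = Matrix.mat m m (\<lambda>(i, j). L $$ (i, j))"
    using assms by (intro submatrix_initial(2)[of _ n]) (auto simp: unit_lower_triangular_def)
  show carr: "submatrix L {..<m} UNIV \<in> carrier_mat m m" by (simp add: L)
  have "det (submatrix L {..<m} UNIV) = prod_list (diag_mat (submatrix L {..<m} UNIV))"
    using assms by (intro det_lower_triangular[OF _ carr]) (auto simp: L unit_lower_triangular_def)
  also have "\<dots> = (\<Prod>i<m. submatrix L {..<m} UNIV $$ (i, i))"
    by (simp add: prod_list_diag_prod carr L atLeast0LessThan)
  also have "\<dots> = 1"
    using assms by (intro prod.neutral) (auto simp: L unit_lower_triangular_def)
  finally show "det (submatrix L {..<m} UNIV) = 1" .
qed

lemma top_inverse: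
  fixes L :: "'a::field mat"
  assumes "unit_lower_triangular L" "L \<in> carrier_mat n m"
  shows "top_inverse m L \<in> carrier_mat m m"
    and "submatrix L {..<m} UNIV * top_inverse m L = 1\<^sub>m m"
proof -
  obtain B where "B \<in> carrier_mat m m" "submatrix L {..<m} UNIV * B = 1\<^sub>m m"
    "mat_inverse (submatrix L {..<m} UNIV) = Some B"
    by (rule det_nonzero_inverse[OF unit_lower_triangular_top(1)[OF assms]])
      (simp add: unit_lower_triangular_top(2)[OF assms])
  then show "top_inverse m L \<in> carrier_mat m m" "submatrix L {..<m} UNIV * top_inverse m L = 1\<^sub>m m"
    by (simp_all add: top_inverse_def)
qed

text \<open>The top block of \<open>X\<close> is the top block of \<open>L\<close> times
  \<open>U\<close>, and the former factor has determinant 1; hence \<open>det U\<close> equals the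
  nonzero determinant of the top block of \<open>X\<close>. The form \<open>X * V = L\<close> serves
  both uniqueness and the passage from \<open>X\<close> to \<open>L\<close> in the QR
  factorizations.\<close>

lemma is_LU_invertible:
  fixes X :: "'a::field mat"
  assumes "is_LU n m X L U" and "det (submatrix X {..<m} UNIV) \<noteq> 0"
  obtains V where "V \<in> carrier_mat m m" "upper_triangular V" "U * V = 1\<^sub>m m" "V * U = 1\<^sub>m m" "X * V = L"
proof -
  have L: "L \<in> carrier_mat n m" "unit_lower_triangular L" and U: "U \<in> carrier_mat m m" "upper_triangular U"
    and X: "X = L * U" and "m \<le> n"
    using assms(1) by (auto simp: is_LU_def unit_lower_triangular_def)
  have "det (submatrix X {..<m} UNIV) = det U"
    using det_mult[OF unit_lower_triangular_top(1)[OF L(2,1)] U(1)] unit_lower_triangular_top(2)[OF L(2,1)]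
    by (simp add: X submatrix_top_mult[OF L(1) U(1) \<open>m \<le> n\<close>])
  with assms(2) have "det U \<noteq> 0" by simp
  then obtain V where V: "V \<in> carrier_mat m m" "U * V = 1\<^sub>m m" "V * U = 1\<^sub>m m"
    by (rule det_nonzero_inverse[OF U(1)])
  moreover have "upper_triangular V" by (rule upper_triangular_right_inverse[OF U V(1,2)])
  moreover have "X * V = L"
    unfolding X assoc_mult_mat[OF L(1) U(1) V(1)] V(2) by (rule right_mult_one_mat[OF L(1)])
  ultimately show ?thesis using that by blast
qed

text \<open>Forward substitution, from the top row down: for \<open>i \<le> j\<close> the terms with
  \<open>l < i\<close> vanish by induction, those with \<open>l > i\<close> by the shape of
  \<open>L\<close>, and what remains says that \<open>W\<close> agrees with \<open>L'\<close> on and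
  above the diagonal.\<close>

lemma unit_lower_triangular_mult_upper:
  fixes L L' W :: "'a::field mat"
  assumes L: "L \<in> carrier_mat n m" "unit_lower_triangular L"
    and L': "L' \<in> carrier_mat n m" "unit_lower_triangular L'"
    and W: "W \<in> carrier_mat m m" "upper_triangular W" and eq: "L * W = L'"
  shows "W = 1\<^sub>m m"
proof -
  have "W $$ (i, j) = (if i = j then 1 else 0)" if "i \<le> j" "j < m" for i j
    using that
  proof (induction i rule: less_induct)
    case (less i)
    have "m \<le> n" using L by (auto simp: unit_lower_triangular_def)
    have "(if i = j then 1 else 0) = L' $$ (i, j)"
      using L' less.prems \<open>m \<le> n\<close> by (auto simp: unit_lower_triangular_def)
    also have "\<dots> = (\<Sum>l<m. L $$ (i, l) * W $$ (l, j))"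
      using L W less.prems \<open>m \<le> n\<close> by (simp add: scalar_prod_def atLeast0LessThan flip: eq)
    also have "\<dots> = (\<Sum>l\<in>{i}. L $$ (i, l) * W $$ (l, j))"
    proof (intro sum.mono_neutral_right ballI)
      fix l assume "l \<in> {..<m} - {i}"
      then show "L $$ (i, l) * W $$ (l, j) = 0"
        using L less.prems less.IH[of l] \<open>m \<le> n\<close>
        by (cases "l < i") (auto simp: unit_lower_triangular_def)
    qed (use less.prems in auto)
    also have "\<dots> = W $$ (i, j)"
      using L less.prems by (auto simp: unit_lower_triangular_def)
    finally show ?case ..
  qed
  moreover have "W $$ (i, j) = 0" if "j < i" "i < m" for i j
    using W that by auto
  ultimately have "W $$ (i, j) = (if i = j then 1 else 0)" if "i < m" "j < m" for i j
    using that by (cases "j < i") auto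
  then show ?thesis
    using W by (intro eq_matI) auto
qed

lemma is_LU_unique:
  fixes X :: "'a::field mat"
  assumes LU: "is_LU n m X L U" "is_LU n m X L' U'" and "det (submatrix X {..<m} UNIV) \<noteq> 0"
  shows "L = L' \<and> U = U'"
proof -
  have L: "L \<in> carrier_mat n m" "unit_lower_triangular L" "U \<in> carrier_mat m m" "upper_triangular U" "X = L * U"
    and L': "L' \<in> carrier_mat n m" "unit_lower_triangular L'" "U' \<in> carrier_mat m m"
    using LU by (auto simp: is_LU_def)
  obtain V where V: "V \<in> carrier_mat m m" "upper_triangular V" "V * U' = 1\<^sub>m m" "X * V = L'"
    using is_LU_invertible[OF LU(2) assms(3)] by blast
  \<comment> \<open>With \<open>V\<close> the inverse of \<open>U'\<close>, two factorizations of
    \<open>X\<close> differ by the upper triangular factor \<open>U * V\<close>, which must then be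
    the identity.\<close>
  have "L * (U * V) = L'" using L V by (simp flip: assoc_mult_mat)
  then have UV: "U * V = 1\<^sub>m m"
    using L L' V by (intro unit_lower_triangular_mult_upper[of L n m L'] upper_triangular_mult[of _ _ m]) auto
  have "U = U * (V * U')" using L V by simp
  also have "\<dots> = U * V * U'" using L L' V by simp
  also have "\<dots> = U'" using L' UV by simp
  finally show ?thesis using \<open>L * (U * V) = L'\<close> UV L by simp
qed

text \<open>Column \<open>j\<close> of \<open>U\<^sup>-\<^sup>1\<close> solves a linear system with the leading principal block of size
  \<open>j + 1\<close> as its matrix.\<close>
lemma is_LU_exists:
  fixes X :: "'a::field mat"
  assumes "m \<le> n" and X: "X \<in> carrier_mat n m"
    and det: "\<And>j. j \<in> {1..m} \<Longrightarrow> det (submatrix X {..<j} {..<j}) \<noteq> 0"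
    and det_top: "det (submatrix X {..<m} UNIV) \<noteq> 0"
  shows "\<exists>L U. is_LU n m X L U"
proof -
  have "\<exists>B. B \<in> carrier_mat (Suc j) (Suc j) \<and> submatrix X {..<Suc j} {..<Suc j} * B = 1\<^sub>m (Suc j)"
    if "j < m" for j
    using det_nonzero_inverse[of "submatrix X {..<Suc j} {..<Suc j}" "Suc j"] det[of "Suc j"] that
      submatrix_initial(1)[OF X, of "Suc j" "Suc j"] \<open>m \<le> n\<close> by auto
  then obtain B where B: "B j \<in> carrier_mat (Suc j) (Suc j)"
      "submatrix X {..<Suc j} {..<Suc j} * B j = 1\<^sub>m (Suc j)" if "j < m" for j
    by metis
  \<comment> \<open>Indices start at 0, so column \<open>j\<close> of \<open>V\<close> is the last
    column of the inverse \<open>B j\<close> of the leading block of size \<open>Suc j\<close>,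
    padded with zeros.\<close>
  define V where "V = Matrix.mat m m (\<lambda>(l, j). if l \<le> j then B j $$ (l, j) else 0)"
  have V: "V \<in> carrier_mat m m" "upper_triangular V"
    by (auto simp: V_def)
  have XV: "X * V \<in> carrier_mat n m" using X V by simp
  \<comment> \<open>Only entries on and above the diagonal are prescribed; those below are whatever
    \<open>X * V\<close> gives and become the entries of \<open>L\<close>.\<close>
  have entries: "(X * V) $$ (i, j) = (if i = j then 1 else 0)" if "i \<le> j" "j < m" for i j
  proof -
    have "(X * V) $$ (i, j) = (\<Sum>l<m. X $$ (i, l) * V $$ (l, j))"
      using X V that \<open>m \<le> n\<close> by (simp add: scalar_prod_def atLeast0LessThan)
    also have "\<dots> = (\<Sum>l<Suc j. X $$ (i, l) * V $$ (l, j))"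
      using that by (intro sum.mono_neutral_right) (auto simp: V_def)
    also have "\<dots> = (\<Sum>l<Suc j. X $$ (i, l) * B j $$ (l, j))"
      using that by (intro sum.cong) (auto simp: V_def)
    also have "\<dots> = (submatrix X {..<Suc j} {..<Suc j} * B j) $$ (i, j)"
      using that B(1)[of j] \<open>m \<le> n\<close> submatrix_initial(1)[OF X, of "Suc j" "Suc j"]
      by (simp add: scalar_prod_def atLeast0LessThan del: sum.lessThan_Suc)
    finally show ?thesis using that by (simp add: B(2))
  qed
  have XV_lower: "unit_lower_triangular (X * V)"
    unfolding unit_lower_triangular_def using XV \<open>m \<le> n\<close> entries X V by auto
  \<comment> \<open>The top block of \<open>X * V\<close> is unit lower triangular, so its
    determinant is 1 and the factor \<open>V\<close> cannot be singular; \<open>U\<close> is its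
    inverse.\<close>
  have "det (submatrix X {..<m} UNIV * V) = 1"
    using unit_lower_triangular_top(2)[OF XV_lower XV] submatrix_top_mult[OF X V(1) \<open>m \<le> n\<close>] by simp
  moreover have "submatrix X {..<m} UNIV \<in> carrier_mat m m"
    by (simp add: submatrix_initial(2)[OF X \<open>m \<le> n\<close>])
  ultimately have "det V \<noteq> 0"
    using det_mult[OF _ V(1)] by (metis mult_zero_right zero_neq_one)
  then obtain U where U: "U \<in> carrier_mat m m" "V * U = 1\<^sub>m m"
    using det_nonzero_inverse[OF V(1)] by blast
  have "X * V * U = X" using X V U by simp
  moreover have "upper_triangular U" by (rule upper_triangular_right_inverse[OF V U])
  ultimately have "is_LU n m X (X * V) U"
    using XV XV_lower U by (simp add: is_LU_def)
  then show ?thesis by blast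
qed

section \<open>Diagonal powers, conjugation and graded orthonormal factorizations\<close>

lemma mat_diag_pow: "mat_diag n f ^\<^sub>m k = mat_diag n (\<lambda>i. f i ^ k)"
proof (induction k)
  case 0
  show ?case using carrier_matD(1)[OF mat_diag_dim[of n f]] by simp
next
  case (Suc k)
  then show ?case by (simp add: power_Suc2 del: power_Suc)
qed

text \<open>Take norms in the class axiom and cancel \<open>norm x\<close>.\<close>

lemma norm_conjugate:
  fixes x :: "'a::real_or_complex"
  shows "norm (conjugate x) = norm x"
proof (cases "x = 0")
  case False
  have "norm x * norm (conjugate x) = (norm x)\<^sup>2"
    by (simp add: mult_conjugate_eq_norm flip: norm_mult)
  with False show ?thesis by (simp add: power2_eq_square)
qed simp

lemma tendsto_conjugate_zero:
  fixes f :: "nat \<Rightarrow> 'a::real_or_complex"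
  assumes "f \<longlonglongrightarrow> 0"
  shows "(\<lambda>k. conjugate (f k)) \<longlonglongrightarrow> 0"
  using tendsto_norm_zero[OF assms]
  by (simp add: norm_conjugate flip: tendsto_norm_zero_iff[of "\<lambda>k. conjugate (f k)"])

text \<open>The asymptotics depend only on the ratios of the weights, so the powers of the
  eigenvalues are abstracted to \<open>w\<close>, later \<open>lam i ^ Suc k\<close>. Matrices
  become entry functions, and \<open>factorization\<close> is the entrywise form of the rescaled QR
  factorization.\<close>

locale graded_QR =
  fixes n m :: nat and w :: "nat \<Rightarrow> nat \<Rightarrow> 'a::real_or_complex"
    and L :: "nat \<Rightarrow> nat \<Rightarrow> 'a" and Q S :: "nat \<Rightarrow> nat \<Rightarrow> nat \<Rightarrow> 'a"
  assumes m_le_n: "m \<le> n"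
    and w_nonzero: "i < n \<Longrightarrow> w k i \<noteq> 0"
    and w_ratio: "i < j \<Longrightarrow> j < n \<Longrightarrow> (\<lambda>k. w k j / w k i) \<longlonglongrightarrow> 0"
    and L_diag: "j < m \<Longrightarrow> L j j = 1"
    and L_upper: "i < j \<Longrightarrow> j < m \<Longrightarrow> L i j = 0"
    and orthonormal: "a < m \<Longrightarrow> b < m \<Longrightarrow>
      (\<Sum>i<n. Q k i a * conjugate (Q k i b)) = (if a = b then 1 else 0)"
    and S_lower: "b < a \<Longrightarrow> a < m \<Longrightarrow> S k a b = 0"
    and factorization: "i < n \<Longrightarrow> j < m \<Longrightarrow>
      L i j * (w k i / w k j) = (\<Sum>l<m. Q k i l * S k l j)"
begin

text \<open>Multiplying \<open>factorization\<close> on the left by the adjoint of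
  \<open>Q k\<close> isolates \<open>S k\<close>, since the columns of \<open>Q k\<close> are
  orthonormal.\<close>

lemma S_eq:
  assumes "a < m" "b < m"
  shows "S k a b = (\<Sum>i<n. conjugate (Q k i a) * (L i b * (w k i / w k b)))"
proof -
  have "(\<Sum>i<n. conjugate (Q k i a) * (L i b * (w k i / w k b)))
      = (\<Sum>i<n. \<Sum>l<m. conjugate (Q k i a) * (Q k i l * S k l b))"
    using assms by (simp add: factorization sum_distrib_left del: times_divide_eq_right)
  also have "\<dots> = (\<Sum>l<m. S k l b * (\<Sum>i<n. Q k i l * conjugate (Q k i a)))"
    by (subst sum.swap) (simp add: sum_distrib_left mult_ac)
  also have "\<dots> = (\<Sum>l<m. if l = a then S k l b else 0)"
    using assms by (intro sum.cong) (auto simp: orthonormal)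
  also have "\<dots> = S k a b"
    using assms by (simp add: sum.delta)
  finally show ?thesis ..
qed

text \<open>A matrix with orthonormal columns acts as an isometry, so the columns of
  \<open>S k\<close> and of the graded matrix have equal norms.\<close>

lemma column_norm_eq:
  assumes "j < m"
  shows "(\<Sum>l<m. (norm (S k l j))\<^sup>2) = (\<Sum>i<n. (norm (L i j * (w k i / w k j)))\<^sup>2)"
proof -
  let ?M = "\<lambda>i. L i j * (w k i / w k j)"
  have "(\<Sum>i<n. ?M i * conjugate (?M i))
      = (\<Sum>i<n. \<Sum>l<m. Q k i l * S k l j * conjugate (?M i))"
    using assms by (simp add: factorization sum_distrib_right del: times_divide_eq_right)
  also have "\<dots> = (\<Sum>l<m. S k l j * (\<Sum>i<n. Q k i l * conjugate (?M i)))"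
    by (subst sum.swap) (simp add: sum_distrib_left mult_ac)
  \<comment> \<open>The inner sum is the conjugate of the expression for \<open>S k l j\<close> in
    \<open>S_eq\<close>.\<close>
  also have "\<dots> = (\<Sum>l<m. S k l j * conjugate (S k l j))"
    using assms by (intro sum.cong) (simp_all add: S_eq sum_conjugate conjugate_dist_mul del: times_divide_eq_right)
  finally have "(\<Sum>i<n. (norm (?M i))\<^sup>2) *\<^sub>R (1::'a) = (\<Sum>l<m. (norm (S k l j))\<^sup>2) *\<^sub>R 1"
    by (simp add: mult_conjugate_eq_norm scaleR_left.sum)
  then show ?thesis by simp
qed

text \<open>Undoing the normalization multiplies a convergent sequence by
  \<open>w k i / w k l\<close>, which tends to 0 for \<open>l < i\<close>.\<close>

lemma Q_null:
  assumes "(\<lambda>k. norm (Q k i l * (w k l / w k i))) \<longlonglongrightarrow> c" "l < i" "i < n"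
  shows "(\<lambda>k. Q k i l) \<longlonglongrightarrow> 0"
proof -
  have "(\<lambda>k. norm (Q k i l * (w k l / w k i)) * norm (w k i / w k l)) \<longlonglongrightarrow> c * norm (0::'a)"
    using assms by (intro tendsto_mult tendsto_norm w_ratio)
  moreover have "norm (Q k i l * (w k l / w k i)) * norm (w k i / w k l) = norm (Q k i l)" for k
    using assms w_nonzero[of i k] w_nonzero[of l k] by (simp flip: norm_mult)
  ultimately show ?thesis by (simp add: tendsto_norm_zero_iff)
qed

text \<open>The convergences feed each other from column to column: column \<open>j\<close> of \<open>S\<close> is controlled by
  the earlier columns of \<open>Q\<close>, and column \<open>j\<close> of \<open>Q\<close> then by back substitution in
  \<open>factorization\<close>.\<close>
lemma column_limits:
  assumes "j < m"
  shows "(\<lambda>k. norm (S k j j)) \<longlonglongrightarrow> 1 \<and> (\<forall>l<j. (\<lambda>k. S k l j) \<longlonglongrightarrow> 0) \<and>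
    (\<forall>i. j \<le> i \<longrightarrow> i < n \<longrightarrow> (\<lambda>k. norm (Q k i j * (w k j / w k i))) \<longlonglongrightarrow> norm (L i j))"
  using assms
proof (induction j rule: less_induct)
  case (less j)
  note j = \<open>j < m\<close>
  have jn: "j < n" using j m_le_n by simp
  \<comment> \<open>Column \<open>j\<close> of the graded matrix tends to the \<open>j\<close>-th
    unit vector.\<close>
  have M: "(\<lambda>k. L i j * (w k i / w k j)) \<longlonglongrightarrow> (if i = j then 1 else 0)" if "i < n" for i
  proof (cases i j rule: linorder_cases)
    case less
    then show ?thesis using j by (simp add: L_upper)
  next
    case equal
    then show ?thesis using j jn by (simp add: L_diag w_nonzero)
  next
    case greater
    then show ?thesis using tendsto_mult_left[OF w_ratio[of j i], of "L i j"] that by simp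
  qed
  have Q0: "(\<lambda>k. Q k i l) \<longlonglongrightarrow> 0" if "l < j" "l < i" "i < n" for i l
    using less.IH[of l] that j by (intro Q_null[of i l "norm (L i l)"]) auto
  \<comment> \<open>In \<open>S_eq\<close> the terms with \<open>i < j\<close> vanish because
    \<open>L\<close> is lower triangular; for \<open>i \<ge> j\<close> the entry of \<open>Q\<close>
    lies below the diagonal in an earlier column and tends to 0.\<close>
  have S0: "(\<lambda>k. S k l j) \<longlonglongrightarrow> 0" if "l < j" for l
  proof -
    have "(\<lambda>k. conjugate (Q k i l) * (L i j * (w k i / w k j))) \<longlonglongrightarrow> 0" if "i < n" for i
    proof (cases "i < j")
      case True
      then show ?thesis using j by (simp add: L_upper)
    next
      case False
      have "(\<lambda>k. conjugate (Q k i l)) \<longlonglongrightarrow> 0"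
        using False \<open>l < j\<close> that by (intro tendsto_conjugate_zero Q0) auto
      from tendsto_mult[OF this M[OF that]] show ?thesis by simp
    qed
    then have "(\<lambda>k. \<Sum>i<n. conjugate (Q k i l) * (L i j * (w k i / w k j))) \<longlonglongrightarrow> 0"
      by (intro tendsto_null_sum) auto
    then show ?thesis using that j by (simp add: S_eq)
  qed
  \<comment> \<open>Column \<open>j\<close> of \<open>S k\<close> ends at the diagonal, so the
    squared modulus of \<open>S k j j\<close> is the squared column norm, which tends to 1, minus
    contributions that tend to 0.\<close>
  have "(\<lambda>k. (\<Sum>i<n. (norm (L i j * (w k i / w k j)))\<^sup>2) - (\<Sum>l<j. (norm (S k l j))\<^sup>2))
      \<longlonglongrightarrow> (\<Sum>i<n. (norm (if i = j then 1 else 0 :: 'a))\<^sup>2) - (\<Sum>l<j. (norm (0::'a))\<^sup>2)"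
    using S0 M by (intro tendsto_diff tendsto_sum tendsto_power tendsto_norm) auto
  moreover have "(\<Sum>i<n. (norm (L i j * (w k i / w k j)))\<^sup>2) - (\<Sum>l<j. (norm (S k l j))\<^sup>2)
      = (norm (S k j j))\<^sup>2" for k
  proof -
    have "(\<Sum>l<m. (norm (S k l j))\<^sup>2) = (\<Sum>l<Suc j. (norm (S k l j))\<^sup>2)"
      using j by (intro sum.mono_neutral_right) (auto simp: S_lower)
    then show ?thesis using column_norm_eq[OF j, of k] by simp
  qed
  moreover have "(\<Sum>i<n. (norm (if i = j then 1 else 0 :: 'a))\<^sup>2) = 1"
    using jn by (simp add: if_distrib if_distribR sum.delta cong: if_cong)
  ultimately have "(\<lambda>k. (norm (S k j j))\<^sup>2) \<longlonglongrightarrow> 1" by simp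
  from tendsto_real_sqrt[OF this] have S1: "(\<lambda>k. norm (S k j j)) \<longlonglongrightarrow> 1" by simp
  have "(\<lambda>k. norm (Q k i j * (w k j / w k i))) \<longlonglongrightarrow> norm (L i j)" if "j \<le> i" "i < n" for i
  proof -
    let ?q = "\<lambda>k l. Q k i l * (w k l / w k i)"
    \<comment> \<open>Row \<open>i\<close> of \<open>factorization\<close> is solved for its last
      term and multiplied by \<open>w k j / w k i\<close>. This ratio is split at
      \<open>w k l\<close>, so that the earlier columns appear in the normalized form of the
      induction hypothesis.\<close>
    have eq: "?q k j * S k j j = L i j - (\<Sum>l<j. ?q k l * (w k j / w k l) * S k l j)" for k
    proof -
      have "L i j * (w k i / w k j) = (\<Sum>l<Suc j. Q k i l * S k l j)"
        unfolding factorization[OF \<open>i < n\<close> j] using j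
        by (intro sum.mono_neutral_right) (auto simp: S_lower)
      moreover have "L i j = L i j * (w k i / w k j) * (w k j / w k i)"
        using w_nonzero[OF \<open>i < n\<close>, of k] w_nonzero[OF jn, of k] by simp
      ultimately have "L i j = (\<Sum>l<Suc j. Q k i l * S k l j) * (w k j / w k i)" by metis
      also have "\<dots> = (\<Sum>l<Suc j. ?q k l * (w k j / w k l) * S k l j)"
        unfolding sum_distrib_right using jn
        by (intro sum.cong) (auto simp: w_nonzero)
      finally show ?thesis using w_nonzero[OF jn, of k] by simp
    qed
    have "(\<lambda>k. ?q k l * (w k j / w k l) * S k l j) \<longlonglongrightarrow> 0" if "l < j" for l
    proof (rule tendsto_norm_zero_cancel)
      have "(\<lambda>k. norm (?q k l) * norm (w k j / w k l) * norm (S k l j))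
          \<longlonglongrightarrow> norm (L i l) * norm (0::'a) * norm (0::'a)"
        using that j jn \<open>j \<le> i\<close> \<open>i < n\<close>
        by (intro tendsto_mult[OF tendsto_mult] tendsto_norm[OF w_ratio] tendsto_norm[OF S0])
          (use less.IH[of l] in auto)
      then show "(\<lambda>k. norm (?q k l * (w k j / w k l) * S k l j)) \<longlonglongrightarrow> 0"
        by (simp only: norm_mult norm_zero mult_zero_right)
    qed
    then have "(\<lambda>k. L i j - (\<Sum>l<j. ?q k l * (w k j / w k l) * S k l j)) \<longlonglongrightarrow> L i j - 0"
      by (intro tendsto_diff tendsto_const tendsto_null_sum) auto
    then have "(\<lambda>k. norm (?q k j * S k j j)) \<longlonglongrightarrow> norm (L i j)"
      unfolding eq by (intro tendsto_norm) simp
    then have "(\<lambda>k. norm (?q k j * S k j j) / norm (S k j j)) \<longlonglongrightarrow> norm (L i j) / 1"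
      using S1 by (rule tendsto_divide) simp
    \<comment> \<open>Division by \<open>norm (S k j j)\<close> is justified only for large
      \<open>k\<close>, where its limit 1 keeps it positive.\<close>
    moreover have "\<forall>\<^sub>F k in sequentially. norm (S k j j) > 0"
      using S1 by (rule order_tendstoD) simp
    then have "\<forall>\<^sub>F k in sequentially. norm (?q k j * S k j j) / norm (S k j j) = norm (?q k j)"
      by eventually_elim (simp add: norm_mult norm_divide)
    ultimately show ?thesis by (simp add: tendsto_cong)
  qed
  with S0 S1 show ?case by blast
qed

text \<open>\<open>N\<close> inverts the top block of \<open>L\<close>, and row \<open>j\<close> of
  the adjoint relation \<open>S_eq\<close>, multiplied by the weights and by \<open>N\<close>,
  exposes the entry above the diagonal. The leading term on the other side is
  \<open>N j i * S k j j\<close>.\<close>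

lemma Q_above_diagonal_limit:
  assumes inverse: "\<And>p i. p < m \<Longrightarrow> i < m \<Longrightarrow> (\<Sum>l<m. L p l * N l i) = (if p = i then 1 else 0)"
    and "i < j" "j < m"
  shows "(\<lambda>k. norm (Q k i j * (w k i / w k j))) \<longlonglongrightarrow> norm (N j i)"
proof -
  have im: "i < m" and jn: "j < n" and i_n: "i < n" using assms m_le_n by auto
  have Q0: "(\<lambda>k. Q k p j) \<longlonglongrightarrow> 0" if "j < p" "p < n" for p
    using column_limits[OF \<open>j < m\<close>] that by (intro Q_null[of p j "norm (L p j)"]) auto
  \<comment> \<open>\<open>T\<close> and \<open>E\<close> are the summands of the two sides of that
    relation for column \<open>i\<close> of \<open>N\<close>, both divided by
    \<open>w k j\<close>.\<close>
  define T where "T k l = N l i * (w k l / w k j) * S k j l" for k l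
  define E where "E k p = conjugate (Q k p j) * (w k p / w k j) * (\<Sum>l<m. L p l * N l i)" for k p
  \<comment> \<open>For \<open>p < m\<close> the factor in \<open>E\<close> is an entry of the
    identity, leaving only \<open>p = i\<close>; the rows from \<open>m\<close> on lie outside the
    inverted block and stay as an error. The terms \<open>T k l\<close> with \<open>l < j\<close>
    vanish since \<open>S\<close> is upper triangular.\<close>
  have eq: "conjugate (Q k i j) * (w k i / w k j) = T k j + ((\<Sum>l\<in>{j<..<m}. T k l) - (\<Sum>p\<in>{m..<n}. E k p))" for k
  proof -
    have "(\<Sum>l<m. T k l) = (\<Sum>l<m. \<Sum>p<n. conjugate (Q k p j) * (w k p / w k j) * (L p l * N l i))"
      unfolding T_def using \<open>j < m\<close> jn m_le_n w_nonzero[of _ k]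
      by (intro sum.cong) (auto simp: S_eq sum_distrib_left intro!: sum.cong)
    also have "\<dots> = (\<Sum>p<n. E k p)"
      by (subst sum.swap) (simp add: E_def sum_distrib_left)
    also have "\<dots> = (\<Sum>p<m. E k p) + (\<Sum>p\<in>{m..<n}. E k p)"
      using m_le_n by (subst sum.union_disjoint[symmetric]) (auto intro: sum.cong)
    also have "(\<Sum>p<m. E k p) = (\<Sum>p<m. if p = i then conjugate (Q k p j) * (w k p / w k j) else 0)"
      using im by (intro sum.cong) (auto simp: E_def inverse)
    also have "\<dots> = conjugate (Q k i j) * (w k i / w k j)"
      using im by simp
    finally have "conjugate (Q k i j) * (w k i / w k j) = (\<Sum>l<m. T k l) - (\<Sum>p\<in>{m..<n}. E k p)" by simp
    moreover have "(\<Sum>l<m. T k l) = (\<Sum>l\<in>insert j {j<..<m}. T k l)"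
      using \<open>j < m\<close> by (intro sum.mono_neutral_right) (auto simp: T_def S_lower)
    ultimately show ?thesis by simp
  qed
  have "(\<lambda>k. T k l) \<longlonglongrightarrow> 0" if "l \<in> {j<..<m}" for l
  proof -
    have "(\<lambda>k. T k l) \<longlonglongrightarrow> N l i * 0 * 0"
      unfolding T_def using that column_limits[of l] m_le_n
      by (intro tendsto_mult tendsto_const w_ratio) auto
    then show ?thesis by simp
  qed
  moreover have "(\<lambda>k. E k p) \<longlonglongrightarrow> 0" if "p \<in> {m..<n}" for p
  proof -
    have "(\<lambda>k. conjugate (Q k p j)) \<longlonglongrightarrow> 0"
      using that \<open>j < m\<close> by (intro tendsto_conjugate_zero Q0) auto
    then have "(\<lambda>k. E k p) \<longlonglongrightarrow> 0 * 0 * (\<Sum>l<m. L p l * N l i)"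
      unfolding E_def using that \<open>j < m\<close> by (intro tendsto_mult tendsto_const w_ratio) auto
    then show ?thesis by simp
  qed
  ultimately have rest: "(\<lambda>k. (\<Sum>l\<in>{j<..<m}. T k l) - (\<Sum>p\<in>{m..<n}. E k p)) \<longlonglongrightarrow> 0 - 0"
    by (intro tendsto_diff tendsto_null_sum) auto
  have "T k j = N j i * S k j j" for k
    using w_nonzero[OF jn] by (simp add: T_def)
  then have "(\<lambda>k. norm (T k j)) \<longlonglongrightarrow> norm (N j i)"
    using column_limits[OF \<open>j < m\<close>] tendsto_mult_left[of "\<lambda>k. norm (S k j j)" 1 sequentially "norm (N j i)"]
    by (simp add: norm_mult)
  \<comment> \<open>The limits control only the modulus of \<open>S k j j\<close>, not its phase, so
    the remainder is removed through the reverse triangle inequality for norms.\<close>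
  moreover have "(\<lambda>k. norm (conjugate (Q k i j) * (w k i / w k j)) - norm (T k j)) \<longlonglongrightarrow> 0"
  proof (rule metric_tendsto_imp_tendsto[OF rest], rule always_eventually, rule allI)
    fix k
    show "dist (norm (conjugate (Q k i j) * (w k i / w k j)) - norm (T k j)) 0
        \<le> dist ((\<Sum>l\<in>{j<..<m}. T k l) - (\<Sum>p\<in>{m..<n}. E k p)) (0 - 0)"
      unfolding eq
      using norm_triangle_ineq3[of "T k j + ((\<Sum>l\<in>{j<..<m}. T k l) - (\<Sum>p\<in>{m..<n}. E k p))" "T k j"]
      by (simp add: dist_norm)
  qed
  ultimately have "(\<lambda>k. norm (conjugate (Q k i j) * (w k i / w k j))) \<longlonglongrightarrow> norm (N j i)"
    by (rule Lim_transform)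
  then show ?thesis by (simp only: norm_mult norm_conjugate)
qed

end

section \<open>Relative errors and the QR factorizations of the given sequence\<close>

lemma ex_relative_error:
  fixes f g :: "nat \<Rightarrow> real"
  assumes "(\<lambda>k. f (Suc k) / g (Suc k)) \<longlonglongrightarrow> 1" and "\<And>k. 1 \<le> k \<Longrightarrow> g k \<noteq> 0"
  shows "\<exists>\<epsilon>. \<epsilon> \<longlonglongrightarrow> 0 \<and> (\<forall>k\<ge>1. f k = g k * (1 + \<epsilon> k))"
\<comment> \<open>The witness is \<open>f k / g k - 1\<close>. Its value at \<open>k = 0\<close>
  affects neither the limit nor the identity, which is claimed from \<open>k = 1\<close> on.\<close>
proof (intro exI conjI allI impI)
  have "(\<lambda>k. f k / g k) \<longlonglongrightarrow> 1"
    using assms(1) by (rule LIMSEQ_imp_Suc)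
  from tendsto_diff[OF this tendsto_const[of 1]] show "(\<lambda>k. f k / g k - 1) \<longlonglongrightarrow> 0" by simp
  show "f k = g k * (1 + (f k / g k - 1))" if "1 \<le> k" for k
    using assms(2)[OF that] by simp
qed

theorem lemma2p1:
  fixes n m :: nat
    and lam :: "nat \<Rightarrow> 'a::real_or_complex"
    and X :: "'a mat"
  assumes "0 < m" and "m \<le> n"
    and "\<And>i j. i < j \<Longrightarrow> j < n \<Longrightarrow> norm (lam j) < norm (lam i)"
    and "0 < norm (lam (n - 1))"
    and "X \<in> carrier_mat n m"
    and "\<And>j. j \<in> {1..m} \<Longrightarrow> det (submatrix X {..<j} {..<j}) \<noteq> 0"
  shows "(\<exists>!(L, U). is_LU n m X L U) \<and>
    (\<forall>L U. is_LU n m X L U \<longrightarrow>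
       strictly_lower_nonzero L \<longrightarrow>
       strictly_lower_nonzero (top_inverse m L) \<longrightarrow>
       (\<forall>Q R. (\<forall>k\<ge>1. is_QR n m (mat_diag n lam ^\<^sub>m k * X) (Q k) (R k)) \<longrightarrow>
         (\<forall>j<m. \<forall>i<n. \<exists>\<epsilon> :: nat \<Rightarrow> real. \<epsilon> \<longlonglongrightarrow> 0 \<and>
            (\<forall>k\<ge>1. norm (Q k $$ (i, j)) =
               (if i < j then
                  norm (top_inverse m L $$ (j, i)) * (norm (lam j) ^ k / norm (lam i) ^ k) * (1 + \<epsilon> k)
                else if i = j then 1 + \<epsilon> k
                else norm (L $$ (i, j)) * (norm (lam i) ^ k / norm (lam j) ^ k) * (1 + \<epsilon> k))))))"
proof -
  note m_le_n = \<open>m \<le> n\<close> and lam_less = assms(3) and X = assms(5)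
  \<comment> \<open>Since \<open>X\<close> has exactly \<open>m\<close> columns, this is the
    hypothesis for \<open>j = m\<close>.\<close>
  have det_top: "det (submatrix X {..<m} UNIV) \<noteq> 0"
    using assms(6)[of m] \<open>0 < m\<close> m_le_n
    by (simp add: submatrix_initial(1)[OF X m_le_n order.refl] submatrix_initial(2)[OF X m_le_n])
  have lam_nonzero: "lam i \<noteq> 0" if "i < n" for i
  proof -
    have "i < n - 1 \<or> i = n - 1" using that by linarith
    then show ?thesis using lam_less[of i "n - 1"] assms(4) by auto
  qed
  have "\<exists>!(L, U). is_LU n m X L U"
  proof -
    obtain L U where "is_LU n m X L U"
      using is_LU_exists[OF m_le_n X assms(6) det_top] by blast
    then show ?thesis
      using is_LU_unique[OF _ _ det_top] by (intro ex1I[of _ "(L, U)"]) auto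
  qed
  moreover have "\<exists>\<epsilon> :: nat \<Rightarrow> real. \<epsilon> \<longlonglongrightarrow> 0 \<and>
      (\<forall>k\<ge>1. norm (Q k $$ (i, j)) =
         (if i < j then
            norm (top_inverse m L $$ (j, i)) * (norm (lam j) ^ k / norm (lam i) ^ k) * (1 + \<epsilon> k)
          else if i = j then 1 + \<epsilon> k
          else norm (L $$ (i, j)) * (norm (lam i) ^ k / norm (lam j) ^ k) * (1 + \<epsilon> k)))"
    if LU: "is_LU n m X L U" and L_nonzero: "strictly_lower_nonzero L"
      and N_nonzero: "strictly_lower_nonzero (top_inverse m L)"
      and QR: "\<And>k. 1 \<le> k \<Longrightarrow> is_QR n m (mat_diag n lam ^\<^sub>m k * X) (Q k) (R k)"
      and j: "j < m" and i: "i < n" for L U Q R i j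
  proof -
    have L: "L \<in> carrier_mat n m" "unit_lower_triangular L"
      using LU by (auto simp: is_LU_def)
    obtain V where V: "V \<in> carrier_mat m m" "upper_triangular V" "X * V = L"
      by (rule is_LU_invertible[OF LU det_top])
    define N where "N = top_inverse m L"
    have N: "N \<in> carrier_mat m m" "submatrix L {..<m} UNIV * N = 1\<^sub>m m"
      unfolding N_def using top_inverse[OF L(2,1)] by auto
    \<comment> \<open>The QR hypothesis starts at exponent 1, hence the shift to
      \<open>Suc k\<close>; \<open>S\<close> is \<open>R * V\<close> with column \<open>j\<close>
      divided by the matching power of \<open>lam j\<close>.\<close>
    define w where "w k i = lam i ^ Suc k" for k i
    define S where "S k l j = (R (Suc k) * V) $$ (l, j) / w k j" for k l j
    have Q: "Q (Suc k) \<in> carrier_mat n m" and R: "R (Suc k) \<in> carrier_mat m m" "upper_triangular (R (Suc k))"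
      and QR_eq: "mat_diag n lam ^\<^sub>m Suc k * X = Q (Suc k) * R (Suc k)" for k
      using QR[of "Suc k"] unfolding is_QR_def by auto
    interpret graded_QR n m w "\<lambda>i j. L $$ (i, j)" "\<lambda>k i j. Q (Suc k) $$ (i, j)" S
    proof
      show "m \<le> n" by fact
      show "w k i \<noteq> 0" if "i < n" for k i
        using lam_nonzero[OF that] by (simp add: w_def)
      show "(\<lambda>k. w k j / w k i) \<longlonglongrightarrow> 0" if "i < j" "j < n" for i j
      proof -
        have "norm (lam j / lam i) < 1"
          using lam_less[OF that] lam_nonzero[of i] that by (simp add: norm_divide)
        from LIMSEQ_Suc[OF LIMSEQ_power_zero[OF this]] show ?thesis
          by (simp only: w_def power_divide)
      qed
      show "L $$ (j, j) = 1" if "j < m" for j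
        using L that by (auto simp: unit_lower_triangular_def)
      show "L $$ (i, j) = 0" if "i < j" "j < m" for i j
        using L that m_le_n by (auto simp: unit_lower_triangular_def)
      show "(\<Sum>i<n. Q (Suc k) $$ (i, a) * conjugate (Q (Suc k) $$ (i, b))) = (if a = b then 1 else 0)"
        if "a < m" "b < m" for k a b
      proof -
        have "col (Q (Suc k)) a \<bullet>c col (Q (Suc k)) b = (if a = b then 1 else 0)"
          using QR[of "Suc k"] that by (simp add: is_QR_def)
        then show ?thesis
          using Q[of k] that by (simp add: scalar_prod_def atLeast0LessThan)
      qed
      show "S k a b = 0" if "b < a" "a < m" for k a b
        using upper_triangularD[OF upper_triangular_mult[OF R(2) V(2) R(1) V(1)], of b a k] R(1)[of k] that
        by (simp add: S_def)
      show "L $$ (i, j) * (w k i / w k j) = (\<Sum>l<m. Q (Suc k) $$ (i, l) * S k l j)"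
        if "i < n" "j < m" for i j k
      proof -
        \<comment> \<open>Multiplying the QR identity by \<open>V\<close> on the right replaces
          \<open>X\<close> by \<open>L\<close> and \<open>R\<close> by \<open>R * V\<close>;
          dividing column \<open>j\<close> by \<open>w k j\<close> then yields the graded
          factorization.\<close>
        have "mat_diag n (\<lambda>i. w k i) * L = mat_diag n lam ^\<^sub>m Suc k * X * V"
          unfolding V(3)[symmetric] mat_diag_pow w_def by (rule assoc_mult_mat[symmetric, OF mat_diag_dim X V(1)])
        also have "\<dots> = Q (Suc k) * (R (Suc k) * V)"
          unfolding QR_eq by (rule assoc_mult_mat[OF Q R(1) V(1)])
        finally have "(mat_diag n (\<lambda>i. w k i) * L) $$ (i, j) = (Q (Suc k) * (R (Suc k) * V)) $$ (i, j)"
          by simp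
        moreover have "(mat_diag n (\<lambda>i. w k i) * L) $$ (i, j) = w k i * L $$ (i, j)"
          using that by (simp add: mat_diag_mult_left[OF L(1)])
        moreover have "(Q (Suc k) * (R (Suc k) * V)) $$ (i, j)
            = (\<Sum>l<m. Q (Suc k) $$ (i, l) * (R (Suc k) * V) $$ (l, j))"
          using Q[of k] R(1)[of k] V that
          by (subst index_mult_mat(1)) (auto simp: scalar_prod_def atLeast0LessThan intro!: sum.cong)
        ultimately show ?thesis
          by (simp add: S_def mult.commute flip: sum_divide_distrib)
      qed
    qed
    have norm_ratio: "norm (w k a / w k b) = norm (lam a) ^ Suc k / norm (lam b) ^ Suc k" for k a b
      by (simp add: w_def norm_divide norm_mult norm_power)
    have jn: "j < n" using j m_le_n by simp
    consider "i < j" | "i = j" | "j < i" by linarith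
    then show ?thesis
    proof cases
      case 1
      \<comment> \<open>For \<open>i < j\<close> this entry of the inverse is strictly below the
        diagonal; being nonzero, it can divide the limit and turn it into a relative error.\<close>
      have "norm (N $$ (j, i)) \<noteq> 0"
        using N_nonzero N(1) 1 j by (auto simp: strictly_lower_nonzero_def simp flip: N_def)
      have "(\<Sum>l<m. L $$ (p, l) * N $$ (l, q)) = (if p = q then 1 else 0)" if "p < m" "q < m" for p q
      proof -
        have "(submatrix L {..<m} UNIV * N) $$ (p, q) = (if p = q then 1 else 0)"
          using that by (simp add: N(2))
        then show ?thesis
          using N(1) that by (simp add: submatrix_initial(2)[OF L(1) m_le_n] scalar_prod_def atLeast0LessThan)
      qed
      from Q_above_diagonal_limit[OF this 1 j]
      have "(\<lambda>k. norm (Q (Suc k) $$ (i, j) * (w k i / w k j)) / norm (N $$ (j, i)))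
          \<longlonglongrightarrow> norm (N $$ (j, i)) / norm (N $$ (j, i))"
        using \<open>norm (N $$ (j, i)) \<noteq> 0\<close> by (intro tendsto_divide tendsto_const) auto
      then have "(\<lambda>k. norm (Q (Suc k) $$ (i, j)) /
          (norm (N $$ (j, i)) * (norm (lam j) ^ Suc k / norm (lam i) ^ Suc k))) \<longlonglongrightarrow> 1"
        unfolding norm_mult norm_ratio using \<open>norm (N $$ (j, i)) \<noteq> 0\<close> by (simp add: field_simps)
      from ex_relative_error[OF this] show ?thesis
        using 1 lam_nonzero[OF i] lam_nonzero[OF jn] \<open>norm (N $$ (j, i)) \<noteq> 0\<close> by (simp add: N_def)
    next
      case 2
      \<comment> \<open>On the diagonal the weights cancel and the limit is the modulus of
        \<open>L $$ (j, j) = 1\<close>; the denominator 1 supplies the reference sequence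
        \<open>g\<close>.\<close>
      have "(\<lambda>k. norm (Q (Suc k) $$ (j, j)) / 1) \<longlonglongrightarrow> 1"
        using column_limits[OF j] jn by (auto simp: w_nonzero L_diag[OF j])
      from ex_relative_error[OF this] show ?thesis
        using 2 by simp
    next
      case 3
      have "norm (L $$ (i, j)) \<noteq> 0"
        using L_nonzero L(1) 3 i j by (auto simp: strictly_lower_nonzero_def)
      have "(\<lambda>k. norm (Q (Suc k) $$ (i, j) * (w k j / w k i)) / norm (L $$ (i, j)))
          \<longlonglongrightarrow> norm (L $$ (i, j)) / norm (L $$ (i, j))"
        using column_limits[OF j] 3 i \<open>norm (L $$ (i, j)) \<noteq> 0\<close>
        by (intro tendsto_divide tendsto_const) (auto simp del: times_divide_eq_right)
      then have "(\<lambda>k. norm (Q (Suc k) $$ (i, j)) /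
          (norm (L $$ (i, j)) * (norm (lam i) ^ Suc k / norm (lam j) ^ Suc k))) \<longlonglongrightarrow> 1"
        unfolding norm_mult norm_ratio using \<open>norm (L $$ (i, j)) \<noteq> 0\<close> by (simp add: field_simps)
      from ex_relative_error[OF this] show ?thesis
        using 3 lam_nonzero[OF i] lam_nonzero[OF jn] \<open>norm (L $$ (i, j)) \<noteq> 0\<close> by simp
    qed
  qed
  ultimately show ?thesis by blast
qed

end
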